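(* Let $r:G\to H$ be an $f$-roundomorphism between topological groups $G$ and $H$. Let $\{\mathcal{B}_T\}_{T>0}$ be a family of measurable subsets of $H$ such that $f$ is bounded on $r^{-1}(\mathcal{B}_T)$ by a constant $F$, uniformly in $T$. If $\{\mathcal{B}_T\}_{T>0}$ is Lipschitz well-rounded in $H$ with parameters $(T_0,C_0)$, then the family $\{r^{-1}(\mathcal{B}_T)\}_{T>0}$ is Lipschitz well-rounded in $G$ with parameters $(T_0,\,F\cdot\max\{C_0,1\})$.
   Context: Let $G,H$ be topological groups with Borel measures $\mu_G,\mu_H$, and let $\{\mathcal{O}^G_\epsilon\}_{\epsilon>0}$, $\{\mathcal{O}^H_\epsilon\}_{\epsilon>0}$ be families of identity neighborhoods in $G$ and $H$ which are nested ($\epsilon_1<\epsilon_2$ implies $\mathcal{O}_{\epsilon_1}\subset\mathcal{O}_{\epsilon_2}$) and symmetric ($\mathcal{O}_\epsilon^{-1}=\mathcal{O}_\epsilon$). Roundomorphism: a Borel measurable map $r:G\to H$ is an $f$-roundomorphism, where $f:G\to\mathbb{R}_{>0}$ is continuous, if (1) $r_*(\mu_G)=\mu_H$; (2) (locally Lipschitz) for every $g\in G$ and every $0<\epsilon<1/f(g)$, $r(\mathcal{O}^G_\epsilon\, g\,\mathcal{O}^G_\epsilon)\subseteq\mathcal{O}^H_{f(g)\epsilon}\,r(g)\,\mathcal{O}^H_{f(g)\epsilon}$. Lipschitz well-rounded: for a subset $\mathcal{B}$ of a group with identity neighborhoods $\mathcal{O}_\epsilon$ put $\mathcal{B}^{(+\epsilon)}=\bigcup_{u,v\in\mathcal{O}_\epsilon}u\mathcal{B}v$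 and $\mathcal{B}^{(-\epsilon)}=\bigcap_{u,v\in\mathcal{O}_\epsilon}u\mathcal{B}v$. A family $\{\mathcal{B}_T\}_{T>0}$ of measurable sets is Lipschitz well-rounded with parameters $(T_0,C)$, with respect to a measure $\mu$, if $\mu(\mathcal{B}_T^{(+\epsilon)})\le(1+C\epsilon)\mu(\mathcal{B}_T^{(-\epsilon)})$ for every $0<\epsilon<1/C$ and $T>T_0$. *)

theory Defs
  imports "HOL-Analysis.Analysis"
begin

text \<open>
  Topological groups are types of class \<^class>\<open>topological_group_add\<close>. Addition is not assumed
  commutative there, so this is the general notion, in additive notation: \<open>u g v\<close> is written
  \<open>u + g + v\<close>, the identity is \<open>0\<close> and the inverse of \<open>u\<close> is \<open>- u\<close>.
\<close>

definition identity_nbhds :: "(real \<Rightarrow> 'a::topological_group_add set) \<Rightarrow> bool" where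
  "identity_nbhds N \<longleftrightarrow>
     (\<forall>\<epsilon>>0. 0 \<in> interior (N \<epsilon>)) \<and>
     (\<forall>\<epsilon>\<^sub>1 \<epsilon>\<^sub>2. 0 < \<epsilon>\<^sub>1 \<and> \<epsilon>\<^sub>1 < \<epsilon>\<^sub>2 \<longrightarrow> N \<epsilon>\<^sub>1 \<subseteq> N \<epsilon>\<^sub>2) \<and>
     (\<forall>\<epsilon>>0. uminus ` N \<epsilon> = N \<epsilon>)"

definition roundomorphism ::
  "'a::topological_group_add measure \<Rightarrow> (real \<Rightarrow> 'a set) \<Rightarrow>
   'b::topological_group_add measure \<Rightarrow> (real \<Rightarrow> 'b set) \<Rightarrow> ('a \<Rightarrow> real) \<Rightarrow> ('a \<Rightarrow> 'b) \<Rightarrow> bool" where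
  "roundomorphism \<mu> N \<nu> K f r \<longleftrightarrow>
     continuous_on UNIV f \<and> (\<forall>g. 0 < f g) \<and>
     r \<in> borel_measurable borel \<and>
     distr \<mu> borel r = \<nu> \<and>
     (\<forall>g \<epsilon>. 0 < \<epsilon> \<and> \<epsilon> < 1 / f g \<longrightarrow>
        r ` {u + g + v | u v. u \<in> N \<epsilon> \<and> v \<in> N \<epsilon>}
          \<subseteq> {u + r g + v | u v. u \<in> K (f g * \<epsilon>) \<and> v \<in> K (f g * \<epsilon>)})"

definition thicken :: "(real \<Rightarrow> 'a::topological_group_add set) \<Rightarrow> real \<Rightarrow> 'a set \<Rightarrow> 'a set" where
  "thicken N \<epsilon> B = (\<Union>u\<in>N \<epsilon>. \<Union>v\<in>N \<epsilon>. (\<lambda>b. u + b + v) ` B)"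

definition erode :: "(real \<Rightarrow> 'a::topological_group_add set) \<Rightarrow> real \<Rightarrow> 'a set \<Rightarrow> 'a set" where
  "erode N \<epsilon> B = (\<Inter>u\<in>N \<epsilon>. \<Inter>v\<in>N \<epsilon>. (\<lambda>b. u + b + v) ` B)"

definition inner_measure_of :: "'a measure \<Rightarrow> 'a set \<Rightarrow> ennreal" where
  "inner_measure_of M A = (SUP B\<in>{B \<in> sets M. B \<subseteq> A}. emeasure M B)"

lemma inner_measure_of_eq [simp]:
  assumes "A \<in> sets M"
  shows "inner_measure_of M A = emeasure M A"
  unfolding inner_measure_of_def
  by (intro antisym SUP_least SUP_upper) (use assms in \<open>auto intro: emeasure_mono\<close>)

text \<open>
  If the neighborhoods \<open>N \<epsilon>\<close> are not open, \<open>thicken N \<epsilon> B\<close> and \<open>erode N \<epsilon> B\<close> need not be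
  Borel, while \<^const>\<open>emeasure\<close> assigns the value \<open>0\<close> to every non-measurable set. The measure of
  the larger set is therefore taken as outer measure and that of the smaller set as inner measure.
  Whenever the two sets are measurable, in particular whenever the neighborhoods are open, this is
  the inequality for the measure itself: see \<open>lipschitz_well_rounded_emeasure\<close> and
  \<open>lipschitz_well_rounded_open\<close> below.
\<close>

definition lipschitz_well_rounded ::
  "'a::topological_group_add measure \<Rightarrow> (real \<Rightarrow> 'a set) \<Rightarrow> (real \<Rightarrow> 'a set) \<Rightarrow>
   real \<Rightarrow> real \<Rightarrow> bool" where
  "lipschitz_well_rounded M N B T\<^sub>0 C \<longleftrightarrow>
     0 < C \<and> (\<forall>T>0. B T \<in> sets M) \<and>
     (\<forall>\<epsilon> T. 0 < \<epsilon> \<and> \<epsilon> < 1 / C \<and> 0 < T \<and> T\<^sub>0 < T \<longrightarrow>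
        outer_measure_of M (thicken N \<epsilon> (B T))
          \<le> ennreal (1 + C * \<epsilon>) * inner_measure_of M (erode N \<epsilon> (B T)))"

lemma lipschitz_well_rounded_emeasure:
  assumes "\<And>\<epsilon> T. 0 < \<epsilon> \<Longrightarrow> 0 < T \<Longrightarrow> thicken N \<epsilon> (B T) \<in> sets M"
    and "\<And>\<epsilon> T. 0 < \<epsilon> \<Longrightarrow> 0 < T \<Longrightarrow> erode N \<epsilon> (B T) \<in> sets M"
  shows "lipschitz_well_rounded M N B T\<^sub>0 C \<longleftrightarrow>
     0 < C \<and> (\<forall>T>0. B T \<in> sets M) \<and>
     (\<forall>\<epsilon> T. 0 < \<epsilon> \<and> \<epsilon> < 1 / C \<and> 0 < T \<and> T\<^sub>0 < T \<longrightarrow>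
        emeasure M (thicken N \<epsilon> (B T)) \<le> ennreal (1 + C * \<epsilon>) * emeasure M (erode N \<epsilon> (B T)))"
  using assms by (auto simp: lipschitz_well_rounded_def)

lemma open_thicken:
  assumes "open (N \<epsilon>)"
  shows "open (thicken N \<epsilon> B)"
proof -
  have "thicken N \<epsilon> B = (\<Union>v\<in>N \<epsilon>. \<Union>b\<in>B. (\<lambda>x. x - v - b) -` N \<epsilon>)"
  proof -
    have "x \<in> thicken N \<epsilon> B \<longleftrightarrow> (\<exists>v\<in>N \<epsilon>. \<exists>b\<in>B. x - v - b \<in> N \<epsilon>)" for x
    proof
      assume "x \<in> thicken N \<epsilon> B"
      then obtain u v b where "u \<in> N \<epsilon>" "v \<in> N \<epsilon>" "b \<in> B" "x = u + b + v"
        by (auto simp: thicken_def)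
      then show "\<exists>v\<in>N \<epsilon>. \<exists>b\<in>B. x - v - b \<in> N \<epsilon>"
        by (intro bexI[of _ v] bexI[of _ b]) auto
    next
      assume "\<exists>v\<in>N \<epsilon>. \<exists>b\<in>B. x - v - b \<in> N \<epsilon>"
      then obtain v b where vb: "v \<in> N \<epsilon>" "b \<in> B" "x - v - b \<in> N \<epsilon>" by blast
      have "x = (x - v - b) + b + v" by simp
      with vb show "x \<in> thicken N \<epsilon> B" unfolding thicken_def by blast
    qed
    then show ?thesis by auto
  qed
  moreover have "open ((\<lambda>x. x - v - b) -` N \<epsilon>)" for v b
    by (rule open_vimage[OF assms]) (simp add: diff_conv_add_uminus continuous_on_add del: add_uminus_conv_diff)
  ultimately show ?thesis by (simp only:) (intro open_UN ballI)
qed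

lemma erode_eq_Compl_thicken: "erode N \<epsilon> B = - thicken N \<epsilon> (- B)"
proof -
  have img: "x \<in> (\<lambda>b. u + b + v) ` A \<longleftrightarrow> - u + x + - v \<in> A" for x u v :: 'a and A
  proof
    assume "- u + x + - v \<in> A"
    moreover have "x = u + (- u + x + - v) + v" by (simp add: add.assoc)
    ultimately show "x \<in> (\<lambda>b. u + b + v) ` A" by blast
  qed (auto simp: add.assoc)
  have "x \<in> erode N \<epsilon> B \<longleftrightarrow> x \<notin> thicken N \<epsilon> (- B)" for x
    unfolding erode_def thicken_def INT_iff UN_iff img by blast
  then show ?thesis by blast
qed

lemma lipschitz_well_rounded_open:
  assumes "\<And>\<epsilon>. 0 < \<epsilon> \<Longrightarrow> open (N \<epsilon>)" "sets M = sets borel"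
  shows "lipschitz_well_rounded M N B T\<^sub>0 C \<longleftrightarrow>
     0 < C \<and> (\<forall>T>0. B T \<in> sets M) \<and>
     (\<forall>\<epsilon> T. 0 < \<epsilon> \<and> \<epsilon> < 1 / C \<and> 0 < T \<and> T\<^sub>0 < T \<longrightarrow>
        emeasure M (thicken N \<epsilon> (B T)) \<le> ennreal (1 + C * \<epsilon>) * emeasure M (erode N \<epsilon> (B T)))"
proof (rule lipschitz_well_rounded_emeasure)
  fix \<epsilon> T :: real assume "0 < \<epsilon>"
  then show "thicken N \<epsilon> (B T) \<in> sets M"
    using assms open_thicken by (metis borel_open)
  show "erode N \<epsilon> (B T) \<in> sets M"
    using assms \<open>0 < \<epsilon>\<close> open_thicken[of N \<epsilon> "- B T"] by (simp add: erode_eq_Compl_thicken borel_closed closed_def)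
qed

end

theory Submission
  imports Defs
begin

text \<open>
  With \<open>\<delta> = F \<epsilon>\<close>, the preimage of the \<open>\<delta>\<close>-thickening of \<open>B\<close> contains the \<open>\<epsilon>\<close>-thickening of the
  preimage of \<open>B\<close>, and the preimage of the \<open>\<delta>\<close>-erosion is contained in the \<open>\<epsilon>\<close>-erosion of the
  preimage. The Lipschitz condition with constant \<open>F\<close> is available only at points over \<open>B\<close>, which
  suffices for the erosion as well: since \<open>0\<close> lies in each neighborhood, the eroded set is part of
  \<open>B\<close>.
\<close>

text \<open>A measurable cover of \<open>A\<close> pulls back to a measurable cover of the preimage,
  with the same measure. Other covers of the preimage may be smaller, so only an inequality is
  claimed; it applies to thickenings that are not measurable.\<close>

lemma outer_measure_of_vimage_le_distr:
  assumes f: "f \<in> measurable M N"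
  shows "outer_measure_of M (f -` A \<inter> space M) \<le> outer_measure_of (distr M N f) A"
  unfolding outer_measure_of_def[of "distr M N f"]
proof (rule INF_greatest)
  fix S assume "S \<in> {S \<in> sets (distr M N f). A \<subseteq> S}"
  then have S: "S \<in> sets N" "A \<subseteq> S" by auto
  have "outer_measure_of M (f -` A \<inter> space M) \<le> outer_measure_of M (f -` S \<inter> space M)"
    using S by (intro outer_measure_of_mono) auto
  also have "\<dots> = emeasure (distr M N f) S"
    using S f by (simp add: emeasure_distr measurable_sets)
  finally show "outer_measure_of M (f -` A \<inter> space M) \<le> emeasure (distr M N f) S" .
qed

lemma inner_measure_of_mono: "A \<subseteq> B \<Longrightarrow> inner_measure_of M A \<le> inner_measure_of M B"
  unfolding inner_measure_of_def by (rule SUP_subset_mono) auto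

text \<open>Dual to the outer bound: measurable sets inside \<open>A\<close> pull back to measurable
  sets inside the preimage, which may contain further ones.\<close>

lemma inner_measure_of_distr_le_vimage:
  assumes f: "f \<in> measurable M N"
  shows "inner_measure_of (distr M N f) A \<le> inner_measure_of M (f -` A \<inter> space M)"
  unfolding inner_measure_of_def[of "distr M N f"]
proof (rule SUP_least)
  fix S assume "S \<in> {S \<in> sets (distr M N f). S \<subseteq> A}"
  then have S: "S \<in> sets N" "S \<subseteq> A" by auto
  \<comment> \<open>The preimage of \<open>S\<close> is measurable, so its inner measure is its
    measure.\<close>
  have "emeasure (distr M N f) S = inner_measure_of M (f -` S \<inter> space M)"
    using S f by (simp add: emeasure_distr measurable_sets)
  also have "\<dots> \<le> inner_measure_of M (f -` A \<inter> space M)"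
    using S by (intro inner_measure_of_mono) auto
  finally show "emeasure (distr M N f) S \<le> inner_measure_of M (f -` A \<inter> space M)" .
qed

lemma identity_nbhds_zero: "identity_nbhds N \<Longrightarrow> 0 < \<epsilon> \<Longrightarrow> 0 \<in> N \<epsilon>"
  using interior_subset unfolding identity_nbhds_def by blast

lemma identity_nbhds_uminus: "identity_nbhds N \<Longrightarrow> 0 < \<epsilon> \<Longrightarrow> u \<in> N \<epsilon> \<Longrightarrow> - u \<in> N \<epsilon>"
  unfolding identity_nbhds_def by blast

text \<open>Nestedness is given for strictly ordered radii; equal radii are added because
  \<open>f g\<close> may attain the bound \<open>F\<close>.\<close>

lemma identity_nbhds_mono: "identity_nbhds N \<Longrightarrow> 0 < \<epsilon> \<Longrightarrow> \<epsilon> \<le> \<delta> \<Longrightarrow> N \<epsilon> \<subseteq> N \<delta>"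
  unfolding identity_nbhds_def by (cases "\<epsilon> = \<delta>") auto

text \<open>By symmetry, the translations by \<open>- u\<close> and \<open>- v\<close> that undo
  \<open>u\<close> and \<open>v\<close> range over the same neighborhood. This puts erosion in terms
  of the points \<open>u + x + v\<close>, which the Lipschitz condition controls.\<close>

lemma mem_erode_iff:
  assumes "identity_nbhds N" "0 < \<epsilon>"
  shows "x \<in> erode N \<epsilon> B \<longleftrightarrow> (\<forall>u\<in>N \<epsilon>. \<forall>v\<in>N \<epsilon>. u + x + v \<in> B)"
proof -
  have "x \<in> thicken N \<epsilon> (- B) \<longleftrightarrow> (\<exists>u\<in>N \<epsilon>. \<exists>v\<in>N \<epsilon>. u + x + v \<in> - B)"
  proof
    assume "x \<in> thicken N \<epsilon> (- B)"
    then obtain u v b where uvb: "u \<in> N \<epsilon>" "v \<in> N \<epsilon>" "b \<in> - B" "x = u + b + v"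
      unfolding thicken_def by blast
    from uvb(4) have "- u + x + - v = b" by (simp add: add.assoc)
    with uvb identity_nbhds_uminus[OF assms] show "\<exists>u\<in>N \<epsilon>. \<exists>v\<in>N \<epsilon>. u + x + v \<in> - B"
      by (intro bexI[of _ "- u"] bexI[of _ "- v"]) auto
  next
    assume "\<exists>u\<in>N \<epsilon>. \<exists>v\<in>N \<epsilon>. u + x + v \<in> - B"
    then obtain u v where uv: "u \<in> N \<epsilon>" "v \<in> N \<epsilon>" "u + x + v \<in> - B" by blast
    have "x = - u + (u + x + v) + - v" by (simp add: add.assoc)
    with uv identity_nbhds_uminus[OF assms] show "x \<in> thicken N \<epsilon> (- B)"
      unfolding thicken_def by blast
  qed
  then show ?thesis by (auto simp: erode_eq_Compl_thicken)
qed

lemma erode_subset: "identity_nbhds N \<Longrightarrow> 0 < \<epsilon> \<Longrightarrow> erode N \<epsilon> B \<subseteq> B"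
  using identity_nbhds_zero[of N \<epsilon>] mem_erode_iff[of N \<epsilon> _ B] by fastforce

text \<open>Replaces the pointwise constant \<open>f g\<close> by \<open>F\<close>: from
  \<open>f g * \<epsilon> \<le> F * \<epsilon> < 1\<close> the radius is admissible at
  \<open>g\<close>, and nestedness then enlarges the neighborhoods in the target.\<close>

lemma roundomorphism_translateE:
  assumes "identity_nbhds K" "roundomorphism \<mu> N \<nu> K f r"
    and "f g \<le> F" "0 < \<epsilon>" "F * \<epsilon> < 1" "u \<in> N \<epsilon>" "v \<in> N \<epsilon>"
  obtains k l where "k \<in> K (F * \<epsilon>)" "l \<in> K (F * \<epsilon>)" "r (u + g + v) = k + r g + l"
proof -
  have fg: "0 < f g" using assms unfolding roundomorphism_def by blast
  have le: "f g * \<epsilon> \<le> F * \<epsilon>" using assms by simp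
  then have "\<epsilon> < 1 / f g" using fg assms(5) by (simp add: field_simps)
  then have "r ` {u + g + v | u v. u \<in> N \<epsilon> \<and> v \<in> N \<epsilon>}
      \<subseteq> {u + r g + v | u v. u \<in> K (f g * \<epsilon>) \<and> v \<in> K (f g * \<epsilon>)}"
    using assms(2,4) unfolding roundomorphism_def by blast
  then obtain k l where "k \<in> K (f g * \<epsilon>)" "l \<in> K (f g * \<epsilon>)" "r (u + g + v) = k + r g + l"
    using assms(6,7) by blast
  moreover have "K (f g * \<epsilon>) \<subseteq> K (F * \<epsilon>)"
    using assms(1,4) fg le by (intro identity_nbhds_mono) auto
  ultimately show thesis using that by blast
qed

lemma thicken_vimage_subset:
  assumes "identity_nbhds K" "roundomorphism \<mu> N \<nu> K f r"
    and "\<And>g. r g \<in> B \<Longrightarrow> f g \<le> F" "0 < \<epsilon>" "F * \<epsilon> < 1"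
  shows "thicken N \<epsilon> (r -` B) \<subseteq> r -` thicken K (F * \<epsilon>) B"
proof
  fix x assume "x \<in> thicken N \<epsilon> (r -` B)"
  then obtain u v g where g: "u \<in> N \<epsilon>" "v \<in> N \<epsilon>" "r g \<in> B" "x = u + g + v"
    unfolding thicken_def by blast
  \<comment> \<open>The Lipschitz condition is centred at \<open>g\<close>, which lies over
    \<open>B\<close>, and not at the translate \<open>x\<close>, where no bound on \<open>f\<close>
    is available.\<close>
  obtain k l where "k \<in> K (F * \<epsilon>)" "l \<in> K (F * \<epsilon>)" "r (u + g + v) = k + r g + l"
    using roundomorphism_translateE[OF assms(1,2) assms(3)[OF g(3)] assms(4,5) g(1,2)] .
  with g show "x \<in> r -` thicken K (F * \<epsilon>) B"
    unfolding thicken_def by blast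
qed

lemma vimage_erode_subset:
  assumes "identity_nbhds N" "identity_nbhds K" "roundomorphism \<mu> N \<nu> K f r"
    and "\<And>g. r g \<in> B \<Longrightarrow> f g \<le> F" "0 < F" "0 < \<epsilon>" "F * \<epsilon> < 1"
  shows "r -` erode K (F * \<epsilon>) B \<subseteq> erode N \<epsilon> (r -` B)"
proof
  fix g assume "g \<in> r -` erode K (F * \<epsilon>) B"
  then have g: "r g \<in> erode K (F * \<epsilon>) B" by simp
  have \<delta>: "0 < F * \<epsilon>" using assms by simp
  have "r g \<in> B" using erode_subset[OF assms(2) \<delta>] g by blast
  then have "f g \<le> F" by (rule assms(4))
  have "r (u + g + v) \<in> B" if uv: "u \<in> N \<epsilon>" "v \<in> N \<epsilon>" for u v
  proof -
    obtain k l where "k \<in> K (F * \<epsilon>)" "l \<in> K (F * \<epsilon>)" "r (u + g + v) = k + r g + l"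
      using roundomorphism_translateE[OF assms(2,3) \<open>f g \<le> F\<close> assms(6,7) uv] .
    \<comment> \<open>\<open>r g\<close> lies in the erosion of radius
      \<open>F * \<epsilon>\<close>, so translating it by \<open>k\<close> and \<open>l\<close>
      stays in \<open>B\<close>.\<close>
    then show ?thesis using g mem_erode_iff[OF assms(2) \<delta>] by simp
  qed
  then show "g \<in> erode N \<epsilon> (r -` B)"
    using mem_erode_iff[OF assms(1,6)] by simp
qed

theorem proposition4p2:
  fixes \<mu>\<^sub>G :: "'g::topological_group_add measure"
    and \<mu>\<^sub>H :: "'h::topological_group_add measure"
    and N\<^sub>G :: "real \<Rightarrow> 'g set" and N\<^sub>H :: "real \<Rightarrow> 'h set"
    and f :: "'g \<Rightarrow> real" and r :: "'g \<Rightarrow> 'h"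
    and B :: "real \<Rightarrow> 'h set" and F T\<^sub>0 C\<^sub>0 :: real
  assumes "sets \<mu>\<^sub>G = sets borel" and "sets \<mu>\<^sub>H = sets borel"
    and "identity_nbhds N\<^sub>G" and "identity_nbhds N\<^sub>H"
    and "roundomorphism \<mu>\<^sub>G N\<^sub>G \<mu>\<^sub>H N\<^sub>H f r"
    and "0 < F" and "\<And>T g. 0 < T \<Longrightarrow> g \<in> r -` B T \<Longrightarrow> f g \<le> F"
    and "lipschitz_well_rounded \<mu>\<^sub>H N\<^sub>H B T\<^sub>0 C\<^sub>0"
  shows "lipschitz_well_rounded \<mu>\<^sub>G N\<^sub>G (\<lambda>T. r -` B T) T\<^sub>0 (F * max C\<^sub>0 1)"
proof -
  \<comment> \<open>The two bounds on \<open>C\<close> serve two purposes: with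
    \<open>\<epsilon> < 1 / (F * C)\<close>, \<open>C \<ge> 1\<close> gives
    \<open>F * \<epsilon> < 1\<close>, as the Lipschitz condition requires, and
    \<open>C \<ge> C\<^sub>0\<close> gives \<open>F * \<epsilon> < 1 / C\<^sub>0\<close>, the range
    of well-roundedness in the target.\<close>
  define C where "C = max C\<^sub>0 1"
  have C: "C\<^sub>0 \<le> C" "1 \<le> C" by (auto simp: C_def)
  have C0: "0 < C\<^sub>0" and B: "\<And>T. 0 < T \<Longrightarrow> B T \<in> sets borel"
    using assms(2,8) unfolding lipschitz_well_rounded_def by auto
  have r: "r \<in> measurable \<mu>\<^sub>G borel" and distr: "distr \<mu>\<^sub>G borel r = \<mu>\<^sub>H"
    using assms(5) unfolding roundomorphism_def measurable_cong_sets[OF assms(1) refl] by blast+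
  have space: "space \<mu>\<^sub>G = UNIV" using sets_eq_imp_space_eq[OF assms(1)] by simp
  have "outer_measure_of \<mu>\<^sub>G (thicken N\<^sub>G \<epsilon> (r -` B T))
      \<le> ennreal (1 + F * C * \<epsilon>) * inner_measure_of \<mu>\<^sub>G (erode N\<^sub>G \<epsilon> (r -` B T))"
    if \<epsilon>: "0 < \<epsilon>" "\<epsilon> < 1 / (F * C)" and T: "0 < T" "T\<^sub>0 < T" for \<epsilon> T
  proof -
    have \<delta>: "0 < F * \<epsilon>" using \<epsilon> assms(6) by simp
    have "C * (F * \<epsilon>) < 1" using \<epsilon> C assms(6) by (simp add: field_simps)
    moreover have "F * \<epsilon> \<le> C * (F * \<epsilon>)" "C\<^sub>0 * (F * \<epsilon>) \<le> C * (F * \<epsilon>)"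
      using mult_right_mono[OF C(1), of "F * \<epsilon>"] mult_right_mono[OF C(2), of "F * \<epsilon>"] \<delta> by simp_all
    ultimately have lt: "F * \<epsilon> < 1" "F * \<epsilon> < 1 / C\<^sub>0"
      using C0 by (simp_all add: pos_less_divide_eq mult.commute)
    have fF: "f g \<le> F" if "r g \<in> B T" for g using that assms(7) T by simp
    have "outer_measure_of \<mu>\<^sub>G (thicken N\<^sub>G \<epsilon> (r -` B T))
        \<le> outer_measure_of \<mu>\<^sub>G (r -` thicken N\<^sub>H (F * \<epsilon>) (B T))"
      by (intro outer_measure_of_mono thicken_vimage_subset[OF assms(4,5) fF \<epsilon>(1) lt(1)])
    also have "\<dots> \<le> outer_measure_of \<mu>\<^sub>H (thicken N\<^sub>H (F * \<epsilon>) (B T))"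
      using outer_measure_of_vimage_le_distr[OF r] by (simp add: space distr)
    \<comment> \<open>Well-roundedness of \<open>B\<close> is applied at radius
      \<open>F * \<epsilon>\<close>; this rescaling is the source of the factor \<open>F\<close> in
      the new constant.\<close>
    also have "\<dots> \<le> ennreal (1 + C\<^sub>0 * (F * \<epsilon>)) * inner_measure_of \<mu>\<^sub>H (erode N\<^sub>H (F * \<epsilon>) (B T))"
      using assms(8) \<delta> lt T unfolding lipschitz_well_rounded_def by blast
    also have "\<dots> \<le> ennreal (1 + F * C * \<epsilon>) * inner_measure_of \<mu>\<^sub>G (erode N\<^sub>G \<epsilon> (r -` B T))"
    proof (rule mult_mono)
      show "ennreal (1 + C\<^sub>0 * (F * \<epsilon>)) \<le> ennreal (1 + F * C * \<epsilon>)"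
        using \<open>C\<^sub>0 * (F * \<epsilon>) \<le> C * (F * \<epsilon>)\<close> by (intro ennreal_leI) (simp add: mult_ac)
      have "inner_measure_of \<mu>\<^sub>H (erode N\<^sub>H (F * \<epsilon>) (B T))
          \<le> inner_measure_of \<mu>\<^sub>G (r -` erode N\<^sub>H (F * \<epsilon>) (B T))"
        using inner_measure_of_distr_le_vimage[OF r] by (simp add: space distr)
      also have "\<dots> \<le> inner_measure_of \<mu>\<^sub>G (erode N\<^sub>G \<epsilon> (r -` B T))"
        by (intro inner_measure_of_mono vimage_erode_subset[OF assms(3-5) fF assms(6) \<epsilon>(1) lt(1)])
      finally show "inner_measure_of \<mu>\<^sub>H (erode N\<^sub>H (F * \<epsilon>) (B T))
          \<le> inner_measure_of \<mu>\<^sub>G (erode N\<^sub>G \<epsilon> (r -` B T))" .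
    qed auto
    finally show ?thesis .
  qed
  moreover have "0 < F * C" using assms(6) C by simp
  moreover have "r -` B T \<in> sets \<mu>\<^sub>G" if "0 < T" for T
    using measurable_sets[OF r B[OF that]] by (simp add: space)
  ultimately show ?thesis
    unfolding lipschitz_well_rounded_def C_def by blast
qed

end
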